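(* Let $n\ge 1$ and let $z\in\mathbb{R}^{n\times n}$ and $w\in\mathbb{R}^{n^2\times n^2}$ have strictly positive entries. Then $$\mathrm{JAP}=\mathrm{OLP}\cap\mathrm{OLP}^{\diamond}\cap\mathrm{OLP}^{T}\cap\mathrm{OLP}^{T\diamond}.$$ Moreover, write $C_1=\mathrm{OLP}$, $C_2=\mathrm{OLP}^{\diamond}$, $C_3=\mathrm{OLP}^{T}$, $C_4=\mathrm{OLP}^{T\diamond}$, set $(x_0,y_0)=(z,w)$, and for $m\ge 1$ define $$(x_m,y_m)=\operatorname*{argmin}_{(x,y)\in C_{((m-1)\bmod 4)+1}} \; KL(x\,\vert\, x_{m-1})+KL(y\,\vert\, y_{m-1}).$$ Then the sequence $(x_m,y_m)$ converges, as $m\to\infty$, to the minimizer of $KL(x\,\vert\, z)+KL(y\,\vert\, w)$ over $(x,y)\in\mathrm{JAP}$.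
   Context: All indices range over $\{1,\dots,n\}$; $x=(x_{ij})\in\mathbb{R}^{n\times n}$ and $y=(y_{ijkl})\in\mathbb{R}^{n^2\times n^2}$. The Johnson–Adams polytope $\mathrm{JAP}$ is the set of $(x,y)$ satisfying: $\sum_j x_{ij}=1$ for all $i$; $\sum_i x_{ij}=1$ for all $j$; $\sum_l y_{ijkl}=x_{ij}$ for all $i,j,k$; $\sum_k y_{ijkl}=x_{ij}$ for all $i,j,l$; $\sum_j y_{ijkl}=x_{kl}$ for all $i,k,l$; $\sum_i y_{ijkl}=x_{kl}$ for all $j,k,l$; and $x,y\ge 0$ entrywise. The one-sided local polytope $\mathrm{OLP}$ is the set of $(x,y)$ satisfying: $\sum_j x_{ij}=1$ for all $i$; $\sum_l y_{ijkl}=x_{ij}$ for all $i,j,k$; and $x,y\ge 0$ entrywise. Put $y^{\diamond}_{ijkl}=y_{klij}$, $y^{T}_{ijkl}=y_{jilk}$, and let $x^T$ be the matrix transpose. Then $\mathrm{OLP}^{\diamond}$ is the set of $(x,y)$ with $(x,y^{\diamond})\in\mathrm{OLP}$; $\mathrm{OLP}^{T}$ is the set of $(x,y)$ with $(x^T,y^T)\in\mathrm{OLP}$; and $\mathrm{OLP}^{T\diamond}$ is the set of $(x,y)$ with $(x^T,(y^T)^{\diamond})\in\mathrm{OLP}$. For a nonnegative array $a=(a_\gamma)$ and a strictly positive array $b=(b_\gamma)$ with the same index set, $KL(a\vert b)=\sum_\gamma a_\gamma\left(\log\frac{a_\gamma}{b_\gamma}-1\right)$, with the convention $0\log 0=0$.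 *)

theory Defs
  imports "HOL-Analysis.Analysis"
begin

text \<open>
  The index set \<open>{1,\<dots>,n}\<close> is a finite type \<open>'n\<close>; as types are nonempty, \<open>n = CARD('n) \<ge> 1\<close>
  holds automatically. The entry written \<open>y\<^sub>i\<^sub>j\<^sub>k\<^sub>l\<close> is \<open>y $ (i,j) $ (k,l)\<close>.
\<close>

type_synonym 'n pt = "(real^'n^'n) \<times> (real^('n \<times> 'n)^('n \<times> 'n))"

definition JAP :: "('n::finite) pt set" where
  "JAP = {(x, y).
     (\<forall>i. (\<Sum>j\<in>UNIV. x $ i $ j) = 1) \<and>
     (\<forall>j. (\<Sum>i\<in>UNIV. x $ i $ j) = 1) \<and>
     (\<forall>i j k. (\<Sum>l\<in>UNIV. y $ (i,j) $ (k,l)) = x $ i $ j) \<and>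
     (\<forall>i j l. (\<Sum>k\<in>UNIV. y $ (i,j) $ (k,l)) = x $ i $ j) \<and>
     (\<forall>i k l. (\<Sum>j\<in>UNIV. y $ (i,j) $ (k,l)) = x $ k $ l) \<and>
     (\<forall>j k l. (\<Sum>i\<in>UNIV. y $ (i,j) $ (k,l)) = x $ k $ l) \<and>
     (\<forall>i j. x $ i $ j \<ge> 0) \<and>
     (\<forall>i j k l. y $ (i,j) $ (k,l) \<ge> 0)}"

definition OLP :: "('n::finite) pt set" where
  "OLP = {(x, y).
     (\<forall>i. (\<Sum>j\<in>UNIV. x $ i $ j) = 1) \<and>
     (\<forall>i j k. (\<Sum>l\<in>UNIV. y $ (i,j) $ (k,l)) = x $ i $ j) \<and>
     (\<forall>i j. x $ i $ j \<ge> 0) \<and>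
     (\<forall>i j k l. y $ (i,j) $ (k,l) \<ge> 0)}"

definition y_diamond ::
    "real^('n \<times> 'n)^('n \<times> 'n) \<Rightarrow> real^('n \<times> 'n)^('n::finite \<times> 'n)" where
  "y_diamond y = (\<chi> ij kl. case (ij, kl) of ((i, j), (k, l)) \<Rightarrow> y $ (k,l) $ (i,j))"

definition y_transp ::
    "real^('n \<times> 'n)^('n \<times> 'n) \<Rightarrow> real^('n \<times> 'n)^('n::finite \<times> 'n)" where
  "y_transp y = (\<chi> ij kl. case (ij, kl) of ((i, j), (k, l)) \<Rightarrow> y $ (j,i) $ (l,k))"

definition OLP_diamond :: "('n::finite) pt set" where
  "OLP_diamond = {(x, y). (x, y_diamond y) \<in> OLP}"

definition OLP_T :: "('n::finite) pt set" where
  "OLP_T = {(x, y). (transpose x, y_transp y) \<in> OLP}"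

definition OLP_T_diamond :: "('n::finite) pt set" where
  "OLP_T_diamond = {(x, y). (transpose x, y_diamond (y_transp y)) \<in> OLP}"

definition pos_entries :: "real^'c^'r \<Rightarrow> bool" where
  "pos_entries a \<longleftrightarrow> (\<forall>r c. a $ r $ c > 0)"

text \<open>
  Only meaningful for \<open>a\<close> nonnegative and \<open>b\<close> strictly positive; the convention
  \<open>0 log 0 = 0\<close> holds because the factor \<open>a $ r $ c\<close> vanishes.
\<close>

definition KL :: "real^'c::finite^'r::finite \<Rightarrow> real^'c^'r \<Rightarrow> real" where
  "KL a b = (\<Sum>r\<in>UNIV. \<Sum>c\<in>UNIV. a $ r $ c * (ln (a $ r $ c / b $ r $ c) - 1))"

definition KL_pt :: "('n::finite) pt \<Rightarrow> 'n pt \<Rightarrow> real" where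
  "KL_pt p q = KL (fst p) (fst q) + KL (snd p) (snd q)"

text \<open>The sets \<open>C\<^sub>1, \<dots>, C\<^sub>4\<close>; other indices are never used.\<close>

definition C_set :: "nat \<Rightarrow> ('n::finite) pt set" where
  "C_set k = (if k = 1 then OLP else if k = 2 then OLP_diamond
              else if k = 3 then OLP_T else OLP_T_diamond)"

text \<open>
  \<open>arg_min\<close> picks an arbitrary minimizer, or an unspecified point if there is none, so a statement
  about \<open>KL_iter\<close> should also assert that the minimizer at each step exists and is unique.
\<close>

fun KL_iter :: "('n::finite) pt \<Rightarrow> nat \<Rightarrow> 'n pt" where
  "KL_iter p0 0 = p0"
| "KL_iter p0 (Suc m) =
     arg_min (\<lambda>p. KL_pt p (KL_iter p0 m)) (\<lambda>p. p \<in> C_set ((Suc m - 1) mod 4 + 1))"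

end

theory Submission
  imports Defs
begin

text \<open>Adding the entries of the second argument to \<open>KL_pt\<close> gives a divergence
  \<open>gen_kl\<close> that is nonnegative, vanishes only on the diagonal and has the same
  minimizers in its first argument. Each of the four sets is cut out of the nonnegative orthant by
  affine equations, and the projection of a positive point is again positive, so it satisfies a
  Pythagorean equality (\<open>is_kl_projection\<close>). For \<open>OLP\<close> the projection is
  explicit (\<open>ex_kl_projection_OLP\<close>); the other three sets are images of
  \<open>OLP\<close> under coordinate permutations that preserve the divergence
  (\<open>kl_projectable_vimage\<close>).

  Convergence (\<open>cyclic_kl_projections_converge\<close>) follows by telescoping the Pythagorean
  equalities. The divergence from a common point to the iterates decreases, and a positive common
  point confines them to a compact part of the open orthant. Consecutive divergences tend to 0, so a
  cluster point lies in every set; being itself a common point, it is the limit of the whole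
  sequence. The telescoped equality passes to the limit and shows that this point is the projection
  of the starting point onto the intersection, which is \<open>JAP\<close>.\<close>

section \<open>Scalar Kullback-Leibler divergence\<close>

definition kl_term :: "real \<Rightarrow> real \<Rightarrow> real" where
  "kl_term a b = a * (ln (a / b) - 1) + b"

lemma kl_term_self [simp]: "kl_term a a = 0"
  by (cases "a = 0") (auto simp: kl_term_def)

text \<open>Hellinger lower bound, from \<open>ln t \<le> t - 1\<close> at
  \<open>t = sqrt (b / a)\<close>. It controls distances without an upper bound on the
  arguments.\<close>

lemma kl_term_ge_sqrt_diff_square:
  assumes "a \<ge> 0" "b > 0"
  shows "kl_term a b \<ge> (sqrt a - sqrt b)\<^sup>2"
proof (cases "a = 0")
  case True
  then show ?thesis using assms by (simp add: kl_term_def)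
next
  case False
  with assms have a: "a > 0" by simp
  have "ln (sqrt (b / a)) \<le> sqrt (b / a) - 1"
    using a assms by (intro ln_le_minus_one) simp
  then have "ln (b / a) \<le> 2 * (sqrt (b / a) - 1)"
    using a assms by (simp add: ln_sqrt)
  then have "a * ln (b / a) \<le> a * (2 * (sqrt (b / a) - 1))"
    using a by (intro mult_left_mono) auto
  moreover have "a * sqrt (b / a) = sqrt a * sqrt b"
    using a by (simp add: real_sqrt_divide field_simps)
  moreover have "ln (a / b) = - ln (b / a)"
    using a assms by (simp add: ln_div)
  ultimately show ?thesis
    using a assms by (simp add: kl_term_def power2_diff algebra_simps)
qed

lemma kl_term_nonneg: "a \<ge> 0 \<Longrightarrow> b > 0 \<Longrightarrow> kl_term a b \<ge> 0"
  using kl_term_ge_sqrt_diff_square[of a b] zero_le_power2[of "sqrt a - sqrt b"] by linarith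

text \<open>Law of cosines for a Bregman divergence. The cross term is linear in \<open>a\<close>,
  so affine constraints can make its sum over the coordinates vanish.\<close>

lemma kl_term_three_point:
  assumes "a \<ge> 0" "b > 0" "c > 0"
  shows "kl_term a b = kl_term a c + kl_term c b + (a - c) * ln (c / b)"
proof (cases "a = 0")
  case True
  then show ?thesis using assms by (simp add: kl_term_def algebra_simps)
next
  case False
  then show ?thesis using assms by (simp add: kl_term_def ln_div algebra_simps)
qed

text \<open>In terms of \<open>t = b / e\<close> the divergence is
  \<open>e * (t - 1 - ln t)\<close>, which blows up both as \<open>t\<close> tends to 0 and as it
  tends to infinity. Bounded divergence from a positive \<open>e\<close> thus keeps \<open>b\<close>
  in a compact subset of the positive axis.\<close>

lemma kl_term_le_imp_bounds:
  assumes "e > 0" "b > 0" "kl_term e b \<le> M"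
  shows "e * exp (- 1 - M / e) \<le> b" "b \<le> 2 * M + 2 * e * ln 2"
proof -
  define t where "t = b / e"
  have t: "t > 0" "b = e * t" using assms by (auto simp: t_def)
  have "kl_term e b = e * (t - 1 - ln t)"
    using assms t by (simp add: kl_term_def ln_div ln_mult algebra_simps)
  with assms have K: "t - 1 - ln t \<le> M / e" by (simp add: field_simps)
  then have "ln t \<ge> - 1 - M / e" using t by linarith
  then have "exp (- 1 - M / e) \<le> t" using t by (simp add: ln_ge_iff)
  then show "e * exp (- 1 - M / e) \<le> b" using assms t by simp
  \<comment> \<open>Halving \<open>t\<close> makes the logarithm absorb only half of the linear
    term, so a bound on \<open>t\<close> survives.\<close>
  have "ln (t / 2) \<le> t / 2 - 1" using t by (intro ln_le_minus_one) simp
  then have "ln t \<le> t / 2 - 1 + ln 2" using t by (simp add: ln_div)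
  with K have "t \<le> 2 * (M / e) + 2 * ln 2" by linarith
  then have "e * t \<le> e * (2 * (M / e) + 2 * ln 2)" using assms by (intro mult_left_mono) auto
  then show "b \<le> 2 * M + 2 * e * ln 2" using assms t by (simp add: algebra_simps)
qed

lemma tendsto_kl_term_right:
  assumes "(g \<longlongrightarrow> b) F" "b > 0"
  shows "((\<lambda>m. kl_term a (g m)) \<longlongrightarrow> kl_term a b) F"
proof (cases "a = 0")
  case True
  then show ?thesis using assms by (simp add: kl_term_def)
next
  case False
  then show ?thesis unfolding kl_term_def using assms by (intro tendsto_intros) auto
qed

section \<open>Divergence on a Euclidean space\<close>

definition pos_vec :: "'a::euclidean_space \<Rightarrow> bool" where
  "pos_vec p \<longleftrightarrow> (\<forall>b\<in>Basis. p \<bullet> b > 0)"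

definition nonneg_vec :: "'a::euclidean_space \<Rightarrow> bool" where
  "nonneg_vec p \<longleftrightarrow> (\<forall>b\<in>Basis. p \<bullet> b \<ge> 0)"

definition gen_kl :: "'a::euclidean_space \<Rightarrow> 'a \<Rightarrow> real" where
  "gen_kl p q = (\<Sum>b\<in>Basis. kl_term (p \<bullet> b) (q \<bullet> b))"

lemma pos_vec_imp_nonneg_vec: "pos_vec p \<Longrightarrow> nonneg_vec p"
  by (auto simp: pos_vec_def nonneg_vec_def less_imp_le)

lemma gen_kl_self [simp]: "gen_kl p p = 0"
  by (simp add: gen_kl_def)

lemma kl_term_le_gen_kl:
  assumes "nonneg_vec p" "pos_vec q" "b \<in> Basis"
  shows "kl_term (p \<bullet> b) (q \<bullet> b) \<le> gen_kl p q"
  unfolding gen_kl_def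
  using assms by (intro member_le_sum kl_term_nonneg) (auto simp: pos_vec_def nonneg_vec_def)

lemma gen_kl_nonneg: "nonneg_vec p \<Longrightarrow> pos_vec q \<Longrightarrow> gen_kl p q \<ge> 0"
  unfolding gen_kl_def by (intro sum_nonneg kl_term_nonneg) (auto simp: pos_vec_def nonneg_vec_def)

lemma abs_sqrt_diff_le_sqrt_gen_kl:
  assumes "nonneg_vec p" "pos_vec q" "b \<in> Basis"
  shows "\<bar>sqrt (p \<bullet> b) - sqrt (q \<bullet> b)\<bar> \<le> sqrt (gen_kl p q)"
proof -
  have "(sqrt (p \<bullet> b) - sqrt (q \<bullet> b))\<^sup>2 \<le> gen_kl p q"
    using kl_term_ge_sqrt_diff_square[of "p \<bullet> b" "q \<bullet> b"] kl_term_le_gen_kl[OF assms] assms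
    by (force simp: pos_vec_def nonneg_vec_def)
  then show ?thesis by (metis real_sqrt_abs real_sqrt_le_iff)
qed

lemma gen_kl_le_0_imp_eq:
  assumes "nonneg_vec p" "pos_vec q" "gen_kl p q \<le> 0"
  shows "p = q"
proof (rule euclidean_eqI)
  fix b :: 'a assume b: "b \<in> Basis"
  have "sqrt (gen_kl p q) = 0" using assms gen_kl_nonneg[of p q] by simp
  then show "p \<bullet> b = q \<bullet> b" using abs_sqrt_diff_le_sqrt_gen_kl[OF assms(1,2) b] by simp
qed

lemma gen_kl_three_point:
  assumes "nonneg_vec p" "pos_vec q" "pos_vec r"
  shows "gen_kl p q = gen_kl p r + gen_kl r q
           + (\<Sum>b\<in>Basis. (p \<bullet> b - r \<bullet> b) * ln ((r \<bullet> b) / (q \<bullet> b)))"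
  unfolding gen_kl_def sum.distrib[symmetric]
  using assms by (intro sum.cong refl kl_term_three_point) (auto simp: pos_vec_def nonneg_vec_def)

lemma tendsto_gen_kl_right:
  fixes p r :: "'a::euclidean_space"
  assumes "(f \<longlongrightarrow> r) F" "nonneg_vec p" "pos_vec r"
  shows "((\<lambda>m. gen_kl p (f m)) \<longlongrightarrow> gen_kl p r) F"
  unfolding gen_kl_def
  using assms
  by (intro tendsto_sum tendsto_kl_term_right tendsto_inner tendsto_const) (auto simp: pos_vec_def)

text \<open>By the Hellinger bound the square roots of the coordinates approach each other, so a
  limit of one sequence is a limit of the other, even on the boundary of the orthant.\<close>

lemma tendsto_iff_if_gen_kl_tendsto_0:
  fixes r :: "'a::euclidean_space"
  assumes lim: "((\<lambda>m. gen_kl (f m) (g m)) \<longlongrightarrow> 0) sequentially"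
    and fg: "\<And>m. nonneg_vec (f m)" "\<And>m. pos_vec (g m)"
  shows "f \<longlonglongrightarrow> r \<longleftrightarrow> g \<longlonglongrightarrow> r"
proof -
  \<comment> \<open>The bound is symmetric in the two sequences, so one argument with generic
    \<open>u\<close> and \<open>v\<close> serves both directions.\<close>
  have conv: "v \<longlonglongrightarrow> r"
    if u: "u \<longlonglongrightarrow> r" "\<And>m. nonneg_vec (u m)" and v: "\<And>m. nonneg_vec (v m)"
      and uv: "\<And>m b. b \<in> Basis \<Longrightarrow> \<bar>sqrt (v m \<bullet> b) - sqrt (u m \<bullet> b)\<bar> \<le> sqrt (gen_kl (f m) (g m))"
    for u v
  proof (rule iffD2[OF tendsto_componentwise_iff], intro ballI)
    fix b :: 'a assume b: "b \<in> Basis"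
    have ub: "(\<lambda>m. u m \<bullet> b) \<longlonglongrightarrow> r \<bullet> b" using u(1) by (intro tendsto_intros)
    have "r \<bullet> b \<ge> 0"
      using ub by (rule LIMSEQ_le_const) (use u(2) b in \<open>auto simp: nonneg_vec_def\<close>)
    have "(\<lambda>m. sqrt (gen_kl (f m) (g m))) \<longlonglongrightarrow> 0"
      using tendsto_real_sqrt[OF lim] by simp
    then have "(\<lambda>m. sqrt (v m \<bullet> b) - sqrt (u m \<bullet> b)) \<longlonglongrightarrow> 0"
      by (rule Lim_null_comparison[rotated]) (simp add: uv[OF b])
    from tendsto_add[OF this tendsto_real_sqrt[OF ub]]
    have "(\<lambda>m. (sqrt (v m \<bullet> b))\<^sup>2) \<longlonglongrightarrow> (sqrt (r \<bullet> b))\<^sup>2"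
      by (intro tendsto_power) simp
    then show "(\<lambda>m. v m \<bullet> b) \<longlonglongrightarrow> r \<bullet> b"
      using v b \<open>r \<bullet> b \<ge> 0\<close> by (simp add: nonneg_vec_def)
  qed
  note bound = abs_sqrt_diff_le_sqrt_gen_kl[OF fg(1) fg(2)]
  show ?thesis
    using conv[of f g] conv[of g f] fg pos_vec_imp_nonneg_vec bound
    by (metis abs_minus_commute)
qed

section \<open>Cyclic projections\<close>

text \<open>
  A Pythagorean equality rather than the usual inequality: the sets below are affine up to the
  sign constraints, which are inactive at a positive minimizer.
\<close>

definition is_kl_projection :: "'a::euclidean_space set \<Rightarrow> 'a \<Rightarrow> 'a \<Rightarrow> bool" where
  "is_kl_projection C q r \<longleftrightarrow>
     r \<in> C \<and> pos_vec r \<and> (\<forall>p\<in>C. gen_kl p q = gen_kl p r + gen_kl r q)"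

text \<open>
  The divergence of any common point to the iterates decreases, and by an amount that does not
  depend on the common point. Since one of these points is positive, the iterates stay away from
  the coordinate hyperplanes and some subsequence has a positive limit.
\<close>

theorem cyclic_kl_projections_converge:
  fixes q :: "nat \<Rightarrow> 'a::euclidean_space" and C :: "nat \<Rightarrow> 'a set"
  assumes N: "N > 0"
    and cl: "\<And>k. k < N \<Longrightarrow> closed (C k)"
    and nn: "\<And>k p. k < N \<Longrightarrow> p \<in> C k \<Longrightarrow> nonneg_vec p"
    and q0: "pos_vec (q 0)"
    and proj: "\<And>m. is_kl_projection (C (m mod N)) (q m) (q (Suc m))"
    and e: "pos_vec e" "e \<in> (\<Inter>k<N. C k)"
  obtains r where "q \<longlonglongrightarrow> r" "is_kl_projection (\<Inter>k<N. C k) (q 0) r"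
proof -
  let ?I = "\<Inter>k<N. C k"
  have pos: "pos_vec (q m)" for m
    using q0 proj by (cases m) (auto simp: is_kl_projection_def)
  note nnq = pos_vec_imp_nonneg_vec[OF pos]
  have nnI: "nonneg_vec p" if "p \<in> ?I" for p using that nn N by blast
  have step: "gen_kl p (q m) = gen_kl p (q (Suc m)) + gen_kl (q (Suc m)) (q m)" if "p \<in> ?I" for p m
  proof -
    have "p \<in> C (m mod N)" using that N by simp
    then show ?thesis using proj[of m] unfolding is_kl_projection_def by blast
  qed
  have dec: "decseq (\<lambda>m. gen_kl p (q m))" if "p \<in> ?I" for p
  proof (rule decseq_SucI)
    show "gen_kl p (q (Suc m)) \<le> gen_kl p (q m)" for m
      using step[OF that, of m] gen_kl_nonneg[OF nnq[of "Suc m"] pos[of m]] by linarith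
  qed
  \<comment> \<open>Each step lowers the divergence by \<open>gen_kl (q (Suc m)) (q m)\<close>,
    whatever the common point, so the total drop can be measured at \<open>e\<close>.\<close>
  have drop: "gen_kl p (q m) = gen_kl p (q 0) - (gen_kl e (q 0) - gen_kl e (q m))" if "p \<in> ?I" for p m
  proof (induction m)
    case (Suc m)
    then show ?case using step[OF that, of m] step[OF e(2), of m] by linarith
  qed simp
  obtain L where L: "(\<lambda>m. gen_kl e (q m)) \<longlonglongrightarrow> L"
    using decseq_convergent[OF dec[OF e(2)], of 0] gen_kl_nonneg[OF nnI[OF e(2)] pos] by blast
  have "(\<lambda>m. gen_kl e (q m) - gen_kl e (q (Suc m))) \<longlonglongrightarrow> L - L"
    by (rule tendsto_diff[OF L LIMSEQ_Suc[OF L]])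
  then have "(\<lambda>m. gen_kl e (q m) - gen_kl e (q (Suc m))) \<longlonglongrightarrow> 0" by simp
  then have gap: "(\<lambda>m. gen_kl (q (Suc m)) (q m)) \<longlonglongrightarrow> 0"
  proof (rule Lim_transform_eventually[OF _ always_eventually])
    show "\<forall>m. gen_kl e (q m) - gen_kl e (q (Suc m)) = gen_kl (q (Suc m)) (q m)"
      using step[OF e(2)] by (metis add_diff_cancel_left')
  qed

  define M where "M = gen_kl e (q 0)"
  have "kl_term (e \<bullet> b) (q m \<bullet> b) \<le> M" if "b \<in> Basis" for b m
    using kl_term_le_gen_kl[OF nnI[OF e(2)] pos that, of m] decseqD[OF dec[OF e(2)], of 0 m]
    by (simp add: M_def)
  then have bounds: "(e \<bullet> b) * exp (- 1 - M / (e \<bullet> b)) \<le> q m \<bullet> b"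
      "q m \<bullet> b \<le> 2 * M + 2 * (e \<bullet> b) * ln 2" if "b \<in> Basis" for b m
    using kl_term_le_imp_bounds[of "e \<bullet> b" "q m \<bullet> b" M] that e pos by (auto simp: pos_vec_def)
  have "range q \<subseteq> cbox 0 (\<Sum>b\<in>Basis. (2 * M + 2 * (e \<bullet> b) * ln 2) *\<^sub>R b)"
    using bounds(2) nnq by (auto simp: mem_box nonneg_vec_def)
  then have "bounded (range q)" using bounded_cbox bounded_subset by blast
  then obtain r s where s: "strict_mono s" "(q \<circ> s) \<longlonglongrightarrow> r"
    using bounded_imp_convergent_subsequence by blast
  have "pos_vec r" unfolding pos_vec_def
  proof
    fix b :: 'a assume b: "b \<in> Basis"
    have "(\<lambda>m. q (s m) \<bullet> b) \<longlonglongrightarrow> r \<bullet> b" using s(2) by (intro tendsto_intros) (simp add: o_def)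
    then have "(e \<bullet> b) * exp (- 1 - M / (e \<bullet> b)) \<le> r \<bullet> b"
      by (rule LIMSEQ_le_const) (use bounds(1)[OF b] in auto)
    moreover have "e \<bullet> b > 0" using e b by (auto simp: pos_vec_def)
    ultimately show "r \<bullet> b > 0" by (meson exp_gt_zero mult_pos_pos less_le_trans)
  qed

  \<comment> \<open>Consecutive divergences vanish, so any fixed delay of the subsequence has the
    same limit.\<close>
  have shift: "(\<lambda>m. q (s m + j)) \<longlonglongrightarrow> r" for j
  proof (induction j)
    case 0
    then show ?case using s(2) by (simp add: o_def)
  next
    case (Suc j)
    have "filterlim (\<lambda>m. s m + j) at_top sequentially"
      using filterlim_subseq[OF s(1)] by (rule filterlim_at_top_mono) auto
    then have "(\<lambda>m. gen_kl (q (Suc (s m + j))) (q (s m + j))) \<longlonglongrightarrow> 0"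
      using gap by (rule filterlim_compose[rotated])
    then show ?case
      using Suc tendsto_iff_if_gen_kl_tendsto_0[of "\<lambda>m. q (Suc (s m + j))" "\<lambda>m. q (s m + j)" r] nnq pos
      by simp
  qed
  have "r \<in> C k" if k: "k < N" for k
  proof (rule closed_sequentially[OF cl[OF k]])
    \<comment> \<open>The number of steps after \<open>s m\<close> until the projection onto
      \<open>C k\<close> is due; adding \<open>N\<close> avoids truncated subtraction. As this delay
      varies with \<open>m\<close>, the distance to \<open>r\<close> is dominated by the sum over
      all \<open>N\<close> possible delays.\<close>
    define j where "j = (\<lambda>m. (k + N - s m mod N) mod N)"
    have j: "j m < N" "(s m + j m) mod N = k" for m
    proof -
      have "s m mod N < N" using N by simp
      have "(s m + j m) mod N = (s m mod N + (k + N - s m mod N)) mod N"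
        unfolding j_def by (simp add: mod_simps)
      also have "s m mod N + (k + N - s m mod N) = k + N" using \<open>s m mod N < N\<close> by simp
      finally show "(s m + j m) mod N = k" using k by simp
    qed (use N in \<open>simp add: j_def\<close>)
    show "q (s m + Suc (j m)) \<in> C k" for m
      using proj[of "s m + j m"] j by (simp add: is_kl_projection_def)
    have "(\<lambda>m. \<Sum>i<N. norm (q (s m + Suc i) - r)) \<longlonglongrightarrow> (\<Sum>i<N. 0)"
      by (intro tendsto_sum tendsto_norm_zero LIM_zero shift)
    then have sum: "(\<lambda>m. \<Sum>i<N. norm (q (s m + Suc i) - r)) \<longlonglongrightarrow> 0" by simp
    have "\<forall>m. norm (q (s m + Suc (j m)) - r) \<le> (\<Sum>i<N. norm (q (s m + Suc i) - r))"
      using j(1) by (intro allI member_le_sum) (auto simp del: add_Suc_right)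
    then have "(\<lambda>m. q (s m + Suc (j m)) - r) \<longlonglongrightarrow> 0"
      by (intro Lim_null_comparison[OF _ sum] always_eventually)
    then show "(\<lambda>m. q (s m + Suc (j m))) \<longlonglongrightarrow> r" by (rule LIM_zero_cancel)
  qed
  then have r: "r \<in> ?I" by auto

  have sub: "filterlim s at_top sequentially" using s(1) by (rule filterlim_subseq)
  obtain L' where L': "(\<lambda>m. gen_kl r (q m)) \<longlonglongrightarrow> L'"
    using decseq_convergent[OF dec[OF r], of 0] gen_kl_nonneg[OF nnI[OF r] pos] by blast
  have "(\<lambda>m. gen_kl r (q (s m))) \<longlonglongrightarrow> gen_kl r r"
    using s(2) nnI[OF r] \<open>pos_vec r\<close> by (intro tendsto_gen_kl_right) (auto simp: o_def)
  moreover have "(\<lambda>m. gen_kl r (q (s m))) \<longlonglongrightarrow> L'"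
    using filterlim_compose[OF L' sub] .
  ultimately have "L' = 0" using LIMSEQ_unique by fastforce
  \<comment> \<open>The divergence from \<open>r\<close> has a limit by monotonicity, and the
    subsequence shows that this limit is 0.\<close>
  then have lim: "q \<longlonglongrightarrow> r"
    using tendsto_iff_if_gen_kl_tendsto_0[of "\<lambda>_. r" q r] L' nnI[OF r] pos by simp

  have "gen_kl p (q 0) = gen_kl p r + gen_kl r (q 0)" if p: "p \<in> ?I" for p
  proof -
    have "(\<lambda>m. gen_kl p (q 0) - gen_kl p (q m)) \<longlonglongrightarrow> gen_kl p (q 0) - gen_kl p r"
      using lim nnI[OF p] \<open>pos_vec r\<close> by (intro tendsto_intros tendsto_gen_kl_right)
    moreover have "(\<lambda>m. gen_kl r (q 0) - gen_kl r (q m)) \<longlonglongrightarrow> gen_kl r (q 0) - gen_kl r r"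
      using lim nnI[OF r] \<open>pos_vec r\<close> by (intro tendsto_intros tendsto_gen_kl_right)
    moreover have "gen_kl p (q 0) - gen_kl p (q m) = gen_kl r (q 0) - gen_kl r (q m)" for m
      using drop[OF p, of m] drop[OF r, of m] by linarith
    ultimately have "gen_kl p (q 0) - gen_kl p r = gen_kl r (q 0) - gen_kl r r"
      using LIMSEQ_unique by (metis (no_types, lifting) LIMSEQ_unique ext)
    then show ?thesis by simp
  qed
  then have "is_kl_projection ?I (q 0) r"
    unfolding is_kl_projection_def using r \<open>pos_vec r\<close> by blast
  with lim show thesis by (rule that)
qed

section \<open>Points in coordinates, and minimizers of \<open>KL_pt\<close>\<close>

lemma sum_Basis_pt:
  fixes G :: "'n::finite pt \<Rightarrow> real"
  shows "(\<Sum>b\<in>Basis. G b) = (\<Sum>i\<in>UNIV. \<Sum>j\<in>UNIV. G (axis i (axis j 1), 0))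
           + (\<Sum>u\<in>UNIV. \<Sum>v\<in>UNIV. G (0, axis u (axis v 1)))"
proof -
  have vec: "(\<Sum>b\<in>Basis. H b) = (\<Sum>i\<in>UNIV. \<Sum>j\<in>UNIV. H (axis i (axis j 1)))"
    for H :: "real^'c::finite^'r::finite \<Rightarrow> real"
  proof -
    let ?f = "\<lambda>(i, j). axis i (axis j 1) :: real^'c^'r"
    have "inj ?f" by (auto simp: inj_on_def axis_eq_axis)
    moreover have "(Basis :: (real^'c^'r) set) = range ?f" by (auto simp: Basis_vec_def)
    ultimately have "sum H Basis = (\<Sum>ij\<in>UNIV. H (?f ij))"
      by (metis (no_types, lifting) sum.reindex_cong)
    then show ?thesis by (simp add: sum.cartesian_product case_prod_unfold)
  qed
  have "(\<Sum>b\<in>Basis. G b) = (\<Sum>b\<in>Basis. G (b, 0)) + (\<Sum>b\<in>Basis. G (0, b))"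
    unfolding Basis_prod_def
    by (subst sum.union_disjoint) (auto simp: sum.reindex inj_on_def o_def)
  then show ?thesis by (simp add: vec)
qed

lemma sum_UNIV_prod: "(\<Sum>u\<in>UNIV. f u) = (\<Sum>i\<in>UNIV. \<Sum>j\<in>UNIV. f (i, j))"
  for f :: "'a::finite \<times> 'b::finite \<Rightarrow> 'c::comm_monoid_add"
  by (simp add: sum.cartesian_product case_prod_unfold)

lemma Ball_Basis_pt:
  "(\<forall>b\<in>Basis. P (b :: 'n::finite pt)) \<longleftrightarrow>
     (\<forall>i j. P (axis i (axis j 1), 0)) \<and> (\<forall>u v. P (0, axis u (axis v 1)))"
  unfolding Basis_prod_def Basis_vec_def by fastforce

lemma inner_pt_axis [simp]:
  "p \<bullet> (axis i (axis j 1), 0) = fst p $ i $ j"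
  "p \<bullet> (0, axis u (axis v 1)) = snd p $ u $ v"
  for p :: "'n::finite pt"
  by (simp_all add: inner_prod_def inner_axis)

lemma pos_vec_pt: "pos_vec p \<longleftrightarrow> pos_entries (fst p) \<and> pos_entries (snd p)"
  for p :: "'n::finite pt"
  unfolding pos_vec_def Ball_Basis_pt by (simp add: pos_entries_def)

lemma nonneg_vec_pt:
  "nonneg_vec p \<longleftrightarrow> (\<forall>i j. fst p $ i $ j \<ge> 0) \<and> (\<forall>u v. snd p $ u $ v \<ge> 0)"
  for p :: "'n::finite pt"
  unfolding nonneg_vec_def Ball_Basis_pt by simp

lemma gen_kl_pt:
  "gen_kl p q = (\<Sum>i\<in>UNIV. \<Sum>j\<in>UNIV. kl_term (fst p $ i $ j) (fst q $ i $ j))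
     + (\<Sum>u\<in>UNIV. \<Sum>v\<in>UNIV. kl_term (snd p $ u $ v) (snd q $ u $ v))"
  for p q :: "'n::finite pt"
  unfolding gen_kl_def sum_Basis_pt by simp

lemma KL_pt_eq_gen_kl: "KL_pt p q = gen_kl p q - (\<Sum>b\<in>Basis. q \<bullet> b)"
  for p q :: "'n::finite pt"
  unfolding gen_kl_pt sum_Basis_pt
  by (simp add: KL_pt_def KL_def kl_term_def sum.distrib)

text \<open>By the Pythagorean equality the excess of \<open>p\<close> over \<open>r\<close> in the
  objective is \<open>gen_kl p r\<close>, which is positive unless \<open>p = r\<close>.\<close>

lemma is_arg_min_KL_pt_iff:
  fixes q r :: "'n::finite pt"
  assumes "is_kl_projection C q r" "\<And>p. p \<in> C \<Longrightarrow> nonneg_vec p"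
  shows "is_arg_min (\<lambda>p. KL_pt p q) (\<lambda>p. p \<in> C) p \<longleftrightarrow> p = r"
proof -
  have r: "r \<in> C" "pos_vec r"
    and pyth: "\<And>p. p \<in> C \<Longrightarrow> gen_kl p q = gen_kl p r + gen_kl r q"
    using assms(1) unfolding is_kl_projection_def by blast+
  have "gen_kl r q \<le> gen_kl p q" if "p \<in> C" for p
    using pyth[OF that] gen_kl_nonneg[OF assms(2)[OF that] r(2)] by linarith
  moreover have "p = r" if "p \<in> C" "gen_kl p q \<le> gen_kl r q" for p
    using pyth[OF that(1)] gen_kl_le_0_imp_eq[OF assms(2)[OF that(1)] r(2)] that(2) by linarith
  ultimately show ?thesis
    using r(1) by (simp add: is_arg_min_linorder KL_pt_eq_gen_kl del: split_paired_All) blast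
qed

section \<open>Explicit projection onto \<open>OLP\<close>\<close>

lemma OLP_nonneg: "p \<in> OLP \<Longrightarrow> nonneg_vec p"
  by (auto simp: OLP_def nonneg_vec_pt)

text \<open>
  For a fixed \<open>x\<close> the best \<open>y\<close> rescales each block \<open>l \<mapsto> y\<^sub>i\<^sub>j\<^sub>k\<^sub>l\<close> to the sum \<open>x\<^sub>i\<^sub>j\<close>; what
  remains is a Gibbs problem in each row of \<open>x\<close>, whose solution is proportional to the geometric
  mean of \<open>x\<^sub>i\<^sub>j\<close> and the \<open>n\<close> block sums.
\<close>

lemma ex_kl_projection_OLP:
  fixes q :: "'n::finite pt"
  assumes "pos_vec q"
  shows "\<exists>r. is_kl_projection OLP q r"
proof -
  obtain x y where q: "q = (x, y)" by fastforce
  have x: "x $ i $ j > 0" and y: "y $ u $ v > 0" for i j u v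
    using assms unfolding q pos_vec_pt pos_entries_def fst_conv snd_conv by iprover+
  \<comment> \<open>The mass of an entry of \<open>x\<close> is counted once for itself and once for
    each of the \<open>n\<close> blocks of \<open>y\<close> that sum to it.\<close>
  define N where "N = 1 + real CARD('n)"
  define S where "S i j k = (\<Sum>l\<in>UNIV. y $ (i,j) $ (k,l))" for i j k
  define L where "L i j = (ln (x $ i $ j) + (\<Sum>k\<in>UNIV. ln (S i j k))) / N" for i j
  define Z where "Z i = (\<Sum>j\<in>UNIV. exp (L i j))" for i
  define a where "a i j = exp (L i j) / Z i" for i j
  define r :: "'n pt" where
    "r = (\<chi> i j. a i j, \<chi> u v. a (fst u) (snd u) * y $ u $ v / S (fst u) (snd u) (fst v))"
  have S: "S i j k > 0" for i j k unfolding S_def by (intro sum_pos y) auto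
  have Z: "Z i > 0" for i unfolding Z_def by (intro sum_pos) auto
  have a: "a i j > 0" for i j using Z by (simp add: a_def)
  have "pos_vec r"
    using a S y by (simp add: pos_vec_pt pos_entries_def r_def)
  have "r \<in> OLP"
  proof -
    have "(\<Sum>j\<in>UNIV. a i j) = 1" for i
      using Z[of i] by (simp add: a_def Z_def flip: sum_divide_distrib)
    moreover have "(\<Sum>l\<in>UNIV. a i j * y $ (i,j) $ (k,l) / S i j k) = a i j" for i j k
      using S[of i j k] by (simp add: S_def flip: sum_divide_distrib sum_distrib_left)
    ultimately show ?thesis using a S y by (auto simp: OLP_def r_def less_imp_le)
  qed
  \<comment> \<open>Lagrange condition: the linear form with coefficients \<open>ln (r / q)\<close>
    is constant on \<open>OLP\<close>. Hence the cross term of the three-point identity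
    vanishes.\<close>
  have lin: "(\<Sum>b\<in>Basis. p \<bullet> b * ln ((r \<bullet> b) / (q \<bullet> b))) = (\<Sum>i\<in>UNIV. - N * ln (Z i))"
    if "p \<in> OLP" for p
  proof -
    obtain s t where p: "p = (s, t)" by fastforce
    have s: "(\<Sum>j\<in>UNIV. s $ i $ j) = 1" and t: "(\<Sum>l\<in>UNIV. t $ (i,j) $ (k,l)) = s $ i $ j" for i j k
      using that by (auto simp: OLP_def p)
    have "ln (snd r $ (i,j) $ (k,l) / y $ (i,j) $ (k,l)) = ln (a i j) - ln (S i j k)" for i j k l
      using a[of i j] S[of i j k] y[of "(i,j)" "(k,l)"] by (simp add: r_def ln_div)
    then have "(\<Sum>k\<in>UNIV. \<Sum>l\<in>UNIV. t $ (i,j) $ (k,l) * ln (snd r $ (i,j) $ (k,l) / y $ (i,j) $ (k,l)))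
        = s $ i $ j * (\<Sum>k\<in>UNIV. ln (a i j) - ln (S i j k))" for i j
      by (simp add: t sum_distrib_left flip: sum_distrib_right)
    moreover have "fst r $ i $ j = a i j" for i j by (simp add: r_def)
    ultimately have "(\<Sum>b\<in>Basis. p \<bullet> b * ln ((r \<bullet> b) / (q \<bullet> b)))
        = (\<Sum>i\<in>UNIV. \<Sum>j\<in>UNIV. s $ i $ j * ln (a i j / x $ i $ j))
          + (\<Sum>i\<in>UNIV. \<Sum>j\<in>UNIV. s $ i $ j * (\<Sum>k\<in>UNIV. ln (a i j) - ln (S i j k)))"
      unfolding sum_Basis_pt inner_pt_axis by (simp add: p q sum_UNIV_prod)
    also have "\<dots> = (\<Sum>i\<in>UNIV. \<Sum>j\<in>UNIV. s $ i $ j *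
                       (ln (a i j / x $ i $ j) + (\<Sum>k\<in>UNIV. ln (a i j) - ln (S i j k))))"
      by (simp add: sum.distrib distrib_left)
    also have "\<dots> = (\<Sum>i\<in>UNIV. \<Sum>j\<in>UNIV. s $ i $ j * (- N * ln (Z i)))"
    proof (intro sum.cong refl arg_cong2[where f = "(*)"])
      fix i j
      have "N > 0" by (simp add: N_def)
      then have NL: "ln (x $ i $ j) + (\<Sum>k\<in>UNIV. ln (S i j k)) = N * L i j" by (simp add: L_def)
      have "ln (a i j) = L i j - ln (Z i)" using Z[of i] by (simp add: a_def ln_div)
      then have "N * ln (a i j) = N * L i j - N * ln (Z i)" by (simp add: right_diff_distrib)
      then show "ln (a i j / x $ i $ j) + (\<Sum>k\<in>UNIV. ln (a i j) - ln (S i j k)) = - N * ln (Z i)"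
        using a[of i j] x[of i j] NL by (simp add: ln_div sum_subtractf N_def algebra_simps)
    qed
    also have "\<dots> = (\<Sum>i\<in>UNIV. - N * ln (Z i))" unfolding sum_distrib_right[symmetric] s by simp
    finally show ?thesis .
  qed
  have "gen_kl p q = gen_kl p r + gen_kl r q" if "p \<in> OLP" for p
    using gen_kl_three_point[OF OLP_nonneg[OF that] assms \<open>pos_vec r\<close>] lin[OF that] lin[OF \<open>r \<in> OLP\<close>]
    by (simp add: left_diff_distrib sum_subtractf)
  then show ?thesis
    unfolding is_kl_projection_def using \<open>r \<in> OLP\<close> \<open>pos_vec r\<close> by blast
qed

section \<open>Transport by symmetries\<close>

lemma y_diamond_nth [simp]: "y_diamond y $ u $ v = y $ v $ u"
  by (cases u; cases v) (simp add: y_diamond_def)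

lemma y_transp_nth [simp]: "y_transp y $ u $ v = y $ prod.swap u $ prod.swap v"
  by (cases u; cases v) (simp add: y_transp_def)

definition diamond_pt :: "'n::finite pt \<Rightarrow> 'n pt" where
  "diamond_pt p = (fst p, y_diamond (snd p))"

definition transp_pt :: "'n::finite pt \<Rightarrow> 'n pt" where
  "transp_pt p = (transpose (fst p), y_transp (snd p))"

lemma OLP_diamond_eq_vimage: "OLP_diamond = diamond_pt -` OLP"
  by (auto simp: OLP_diamond_def diamond_pt_def)

lemma OLP_T_eq_vimage: "OLP_T = transp_pt -` OLP"
  by (auto simp: OLP_T_def transp_pt_def)

text \<open>The transposition acts first, so the fourth set is reached from \<open>OLP\<close> by
  two successive preimages.\<close>

lemma OLP_T_diamond_eq_vimage: "OLP_T_diamond = transp_pt -` OLP_diamond"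
  by (auto simp: OLP_T_diamond_def OLP_diamond_def transp_pt_def)

definition kl_symmetry :: "('n::finite pt \<Rightarrow> 'n pt) \<Rightarrow> bool" where
  "kl_symmetry f \<longleftrightarrow> continuous_on UNIV f \<and> (\<forall>p. f (f p) = p) \<and>
     (\<forall>p. nonneg_vec p \<longleftrightarrow> nonneg_vec (f p)) \<and> (\<forall>p. pos_vec p \<longleftrightarrow> pos_vec (f p)) \<and>
     (\<forall>p q. gen_kl (f p) (f q) = gen_kl p q)"

lemma kl_symmetry_diamond: "kl_symmetry (diamond_pt :: 'n::finite pt \<Rightarrow> 'n pt)"
  unfolding kl_symmetry_def
proof (intro conjI allI)
  have "y_diamond y = (\<chi> u v. y $ v $ u)" for y :: "real^('n \<times> 'n)^('n \<times> 'n)"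
    by (simp add: vec_eq_iff)
  then show "continuous_on UNIV (diamond_pt :: 'n pt \<Rightarrow> _)"
    unfolding diamond_pt_def by (simp, intro continuous_intros)
  fix p q :: "'n pt"
  show "diamond_pt (diamond_pt p) = p"
    by (simp add: diamond_pt_def prod_eq_iff vec_eq_iff)
  show "nonneg_vec p \<longleftrightarrow> nonneg_vec (diamond_pt p)" "pos_vec p \<longleftrightarrow> pos_vec (diamond_pt p)"
    by (auto simp: diamond_pt_def nonneg_vec_pt pos_vec_pt pos_entries_def)
  show "gen_kl (diamond_pt p) (diamond_pt q) = gen_kl p q"
    unfolding gen_kl_pt diamond_pt_def
    by (simp add: sum.swap[of "\<lambda>u v. kl_term (snd p $ v $ u) (snd q $ v $ u)"])
qed

lemma kl_symmetry_transp: "kl_symmetry (transp_pt :: 'n::finite pt \<Rightarrow> 'n pt)"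
  unfolding kl_symmetry_def
proof (intro conjI allI)
  have "y_transp y = (\<chi> u v. y $ prod.swap u $ prod.swap v)" for y :: "real^('n \<times> 'n)^('n \<times> 'n)"
    by (simp add: vec_eq_iff)
  then show "continuous_on UNIV (transp_pt :: 'n pt \<Rightarrow> _)"
    unfolding transp_pt_def transpose_def by (simp, intro continuous_intros)
  fix p q :: "'n pt"
  show "transp_pt (transp_pt p) = p"
    by (simp add: transp_pt_def prod_eq_iff vec_eq_iff transpose_def)
  show "nonneg_vec p \<longleftrightarrow> nonneg_vec (transp_pt p)" "pos_vec p \<longleftrightarrow> pos_vec (transp_pt p)"
    by (auto simp: transp_pt_def nonneg_vec_pt pos_vec_pt pos_entries_def transpose_def)
  have swap: "(\<Sum>u\<in>UNIV. f (prod.swap u)) = (\<Sum>u\<in>UNIV. f u)" for f :: "'n \<times> 'n \<Rightarrow> real"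
    using sum.reindex[of prod.swap UNIV f] by (simp add: surj_swap o_def)
  show "gen_kl (transp_pt p) (transp_pt q) = gen_kl p q"
    unfolding gen_kl_pt transp_pt_def
    by (simp add: transpose_def swap[of "\<lambda>v. kl_term (snd p $ _ $ v) (snd q $ _ $ v)"]
          swap[of "\<lambda>u. \<Sum>v\<in>UNIV. kl_term (snd p $ u $ v) (snd q $ u $ v)"]
          sum.swap[of "\<lambda>i j. kl_term (fst p $ j $ i) (fst q $ j $ i)"])
qed

definition kl_projectable :: "'n::finite pt set \<Rightarrow> bool" where
  "kl_projectable C \<longleftrightarrow> closed C \<and> (\<forall>p\<in>C. nonneg_vec p) \<and>
     (\<forall>q. pos_vec q \<longrightarrow> (\<exists>r. is_kl_projection C q r))"

text \<open>Conjugation: the projection of \<open>q\<close> onto the preimage is \<open>f\<close>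
  applied to the projection of \<open>f q\<close> onto \<open>C\<close>, since \<open>f\<close> is
  an involution preserving the divergence.\<close>

lemma kl_projectable_vimage:
  assumes C: "kl_projectable C" and f: "kl_symmetry f"
  shows "kl_projectable (f -` C)"
proof -
  have "\<exists>r. is_kl_projection (f -` C) q r" if q: "pos_vec q" for q
  proof -
    have "pos_vec (f q)" using q f unfolding kl_symmetry_def by blast
    then obtain r where r: "is_kl_projection C (f q) r"
      using C unfolding kl_projectable_def by blast
    have "is_kl_projection (f -` C) q (f r)"
      unfolding is_kl_projection_def
    proof (intro conjI ballI)
      show "f r \<in> f -` C" "pos_vec (f r)"
        using r f unfolding is_kl_projection_def kl_symmetry_def by (metis vimageI2)+
      fix p assume "p \<in> f -` C"
      then have "gen_kl (f p) (f q) = gen_kl (f p) r + gen_kl r (f q)"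
        using r unfolding is_kl_projection_def by blast
      then show "gen_kl p q = gen_kl p (f r) + gen_kl (f r) q"
        using f unfolding kl_symmetry_def by metis
    qed
    then show ?thesis ..
  qed
  moreover have "closed (f -` C)"
    using C f unfolding kl_projectable_def kl_symmetry_def by (blast intro: closed_vimage)
  moreover have "\<forall>p\<in>f -` C. nonneg_vec p"
    using C f unfolding kl_projectable_def kl_symmetry_def by blast
  ultimately show ?thesis unfolding kl_projectable_def by blast
qed

lemma kl_projectable_OLP: "kl_projectable OLP"
proof -
  have "closed (OLP :: 'n::finite pt set)"
    unfolding OLP_def case_prod_unfold
    by (intro closed_Collect_conj closed_Collect_all closed_Collect_eq closed_Collect_le continuous_intros)
  then show ?thesis
    using ex_kl_projection_OLP OLP_nonneg by (auto simp: kl_projectable_def)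
qed

lemma kl_projectable_C_set: "kl_projectable (C_set k)"
  unfolding C_set_def OLP_T_diamond_eq_vimage OLP_T_eq_vimage OLP_diamond_eq_vimage
  by (auto intro!: kl_projectable_vimage kl_projectable_OLP kl_symmetry_diamond kl_symmetry_transp)

section \<open>The Johnson-Adams polytope and the conclusion\<close>

text \<open>In the order listed, the four sets supply the marginals of \<open>y\<close> over
  \<open>l\<close>, \<open>j\<close>, \<open>k\<close> and \<open>i\<close>. The first two give the
  row sums of \<open>x\<close>, the last two its column sums.\<close>

lemma JAP_eq_inter_OLP: "JAP = OLP \<inter> OLP_diamond \<inter> OLP_T \<inter> OLP_T_diamond"
  unfolding JAP_def OLP_def OLP_diamond_def OLP_T_def OLP_T_diamond_def
  by (auto simp: transpose_def)

lemma JAP_eq_INT_C_set: "JAP = (\<Inter>k<4. C_set (k + 1))"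
proof -
  have "{..<4::nat} = {0, 1, 2, 3}" by auto
  then show ?thesis unfolding JAP_eq_inter_OLP by (auto simp: C_set_def)
qed

text \<open>The uniform point serves as the positive common point that keeps the iterates away from
  the boundary.\<close>

lemma ex_pos_JAP: "\<exists>p\<in>(JAP :: 'n::finite pt set). pos_vec p"
proof
  let ?n = "real CARD('n)"
  let ?p = "(\<chi> i j. 1 / ?n, \<chi> u v. 1 / ?n\<^sup>2) :: 'n pt"
  show "?p \<in> JAP" by (simp add: JAP_def power2_eq_square)
  show "pos_vec ?p" by (simp add: pos_vec_pt pos_entries_def)
qed

theorem mainTheorem2:
  fixes z :: "real^'n::finite^'n" and w :: "real^('n \<times> 'n)^('n \<times> 'n)"
  assumes "pos_entries z" and "pos_entries w"
  shows "(JAP :: 'n pt set) = OLP \<inter> OLP_diamond \<inter> OLP_T \<inter> OLP_T_diamond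
    \<and> (\<forall>m. pos_entries (fst (KL_iter (z, w) m)) \<and> pos_entries (snd (KL_iter (z, w) m)))
    \<and> (\<forall>m\<ge>1. \<exists>!p. is_arg_min (\<lambda>p. KL_pt p (KL_iter (z, w) (m - 1)))
                          (\<lambda>p. p \<in> C_set ((m - 1) mod 4 + 1)) p)
    \<and> (\<exists>!p. is_arg_min (\<lambda>p. KL_pt p (z, w)) (\<lambda>p. p \<in> JAP) p)
    \<and> KL_iter (z, w) \<longlonglongrightarrow> arg_min (\<lambda>p. KL_pt p (z, w)) (\<lambda>p. p \<in> JAP)"
proof -
  define q where "q = KL_iter (z, w)"
  define C :: "nat \<Rightarrow> 'n pt set" where "C k = C_set (k + 1)" for k
  have C: "kl_projectable (C k)" for k
    unfolding C_def by (rule kl_projectable_C_set)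
  have nn: "nonneg_vec p" if "p \<in> C k" for p k
    using that C unfolding kl_projectable_def by blast
  have step: "is_kl_projection (C (m mod 4)) (q m) (q (Suc m))" if qm: "pos_vec (q m)" for m
  proof -
    obtain r where r: "is_kl_projection (C (m mod 4)) (q m) r"
      using qm C unfolding kl_projectable_def by blast
    \<comment> \<open>The minimizer is unique, so the choice made by \<open>arg_min\<close> is
      forced.\<close>
    have "q (Suc m) = r"
      using is_arg_min_KL_pt_iff[OF r nn] by (simp add: q_def arg_min_def C_def)
    with r show ?thesis by simp
  qed
  have pos: "pos_vec (q m)" for m
  proof (induction m)
    case 0
    then show ?case using assms by (simp add: q_def pos_vec_pt)
  next
    case (Suc m)
    then show ?case using step by (auto simp: is_kl_projection_def)
  qed
  have J: "JAP = (\<Inter>k<4. C k)" by (simp add: JAP_eq_INT_C_set C_def)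
  obtain e :: "'n pt" where "pos_vec e" "e \<in> (\<Inter>k<4. C k)"
    using ex_pos_JAP J by blast
  then obtain r where r: "q \<longlonglongrightarrow> r" "is_kl_projection JAP (q 0) r"
    using cyclic_kl_projections_converge[of 4 C q e] C step pos nn
    unfolding J kl_projectable_def by auto
  have min: "is_arg_min (\<lambda>p. KL_pt p (z, w)) (\<lambda>p. p \<in> JAP) p \<longleftrightarrow> p = r" for p
    using is_arg_min_KL_pt_iff[OF r(2), of p] nn[of _ 0] by (simp add: J q_def)
  have "\<exists>!p. is_arg_min (\<lambda>p. KL_pt p (q (m - 1))) (\<lambda>p. p \<in> C_set ((m - 1) mod 4 + 1)) p" for m
    using is_arg_min_KL_pt_iff[OF step[OF pos] nn, of "m - 1"] by (auto simp: C_def)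
  then show ?thesis
    using JAP_eq_inter_OLP pos r(1) min by (simp add: q_def pos_vec_pt arg_min_def)
qed

end
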